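(* Let $n\ge 2$ be an integer, let $0<\delta<1$, and let $M\ge 1$ be an integer. Let $x_1,x_2,\ldots,x_n$ be independent random variables uniformly distributed on $\mathbb{T}=\mathbb{R}/\mathbb{Z}$, and put $$P(M,n,\delta)=P\Big(\forall m\in\{1,2,\ldots,M\}:\ \Big|\sum_{j=1}^n e^{2\pi i m x_j}\Big|<\delta n\Big).$$ Then for every integer $\nu\ge 3$, $$1-P(M,n,\delta)\le M\,\nu\, e^{-n\delta^2a^2},\qquad a^2=\cos^2\frac{\pi}{\nu}.$$ In particular, this holds with $\nu=\lfloor \delta\pi\sqrt{2n}\rfloor$ whenever $\lfloor \delta\pi\sqrt{2n}\rfloor\ge 3$.
   Context: $P(\cdot)$ denotes the probability of an event. For a real number $y$, $\lfloor y\rfloor$ is its integer part. *)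

theory Defs
  imports "HOL-Probability.Probability"
begin

quotient_type circle = real / "\<lambda>x y::real. x - y \<in> \<int>"
  morphisms rep_circle circle_of_real
proof (rule equivpI)
  show "reflp (\<lambda>x y::real. x - y \<in> \<int>)"
    by (simp add: reflp_def)
  show "symp (\<lambda>x y::real. x - y \<in> \<int>)"
    by (metis (mono_tags, lifting) Ints_minus minus_diff_eq sympI)
  show "transp (\<lambda>x y::real. x - y \<in> \<int>)"
  proof (rule transpI)
    fix x y z :: real
    assume "x - y \<in> \<int>" "y - z \<in> \<int>"
    then have "(x - y) + (y - z) \<in> \<int>" by (rule Ints_add)
    then show "x - z \<in> \<int>" by simp
  qed
qed

instantiation circle :: topological_space
begin

definition open_circle :: "circle set \<Rightarrow> bool" where
  "open_circle U \<longleftrightarrow> open (circle_of_real -` U)"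

instance
  by standard (simp_all add: open_circle_def open_Int open_UN vimage_Union)

end

lemma continuous_on_circle_of_real: "continuous_on A circle_of_real"
  by (rule continuous_on_subset[of UNIV])
     (simp_all add: continuous_on_open_vimage open_circle_def)

lemma measurable_circle_of_real [measurable]: "circle_of_real \<in> borel_measurable borel"
  by (intro borel_measurable_continuous_onI continuous_on_circle_of_real)

text \<open>The Haar probability measure, as the image of Lebesgue measure on a fundamental domain.\<close>

definition uniform_circle :: "circle measure" where
  "uniform_circle = distr (uniform_measure lborel {0..<1}) borel circle_of_real"

lemma prob_space_uniform_circle: "prob_space uniform_circle"
proof -
  have "prob_space (uniform_measure lborel {0..<1::real})"
    by (rule prob_space_uniform_measure) simp_all
  then show ?thesis
    unfolding uniform_circle_def by (rule prob_space.prob_space_distr) simp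
qed

lift_definition circle_char :: "nat \<Rightarrow> circle \<Rightarrow> complex" is
  "\<lambda>m x. exp (2 * of_real pi * \<i> * of_nat m * of_real x)"
proof -
  fix m :: nat and x y :: real
  assume "x - y \<in> \<int>"
  then obtain k where k: "x = y + of_int k"
    by (metis Ints_cases add.commute diff_add_cancel)
  have "2 * of_real pi * \<i> * of_nat m * of_real x =
      2 * of_real pi * \<i> * of_nat m * of_real y + of_real (of_int (2 * (int m * k)) * pi) * \<i>"
    unfolding k by (simp add: algebra_simps)
  then show "exp (2 * of_real pi * \<i> * of_nat m * of_real x) =
      exp (2 * of_real pi * \<i> * of_nat m * of_real y)"
    unfolding exp_eq by blast
qed

definition prob_small_sums ::
  "'a measure \<Rightarrow> (nat \<Rightarrow> 'a \<Rightarrow> circle) \<Rightarrow> nat \<Rightarrow> nat \<Rightarrow> real \<Rightarrow> real" where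
  "prob_small_sums \<Omega> x M n \<delta> =
     measure \<Omega> {\<omega> \<in> space \<Omega>. \<forall>m\<in>{1..M}.
       cmod (\<Sum>j=1..n. circle_char m (x j \<omega>)) < \<delta> * real n}"

end

theory Submission imports Defs begin

text \<open>If $|S| \ge \delta n$, then one of the $\nu$ equally spaced directions $\varphi$ makes an
  angle at most $\pi/\nu$ with $S$, so that $\mathrm{Re}(e^{-i\varphi} S) \ge \delta n a$. For fixed
  $m$ and $\varphi$ this real part is a sum of independent copies of $\cos$ of a uniform angle, whose
  moment generating function $I_0(t)$ is at most $e^{t^2/4}$. Chernoff's bound with $t = 2 \delta a$
  and a union bound over $m$ and $\varphi$ finish the proof.\<close>

section \<open>Choosing a nearby direction\<close>

text \<open>Consecutive multiples of 2 pi/N are 2 pi/N apart, so the nearest one lies within pi/N of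
  the argument of \<open>z\<close>, and cos decreases on [0, pi]. For \<open>z = 0\<close> both
  sides are 0, whatever value \<open>Arg\<close> has there.\<close>

lemma ex_direction_Re_ge:
  fixes z :: complex
  assumes N: "N \<ge> 1"
  shows "\<exists>k<N. cmod z * cos (pi / real N) \<le> Re (cis (- (2 * pi * real k / real N)) * z)"
proof -
  \<comment> \<open>\<open>u\<close> is the argument in units of 2 pi/N and \<open>r\<close> its
    nearest integer. Since \<open>Arg\<close> can be negative, so can \<open>r\<close>; its residue
    mod N is the index \<open>k\<close>, and the quotient \<open>q\<close> counts full turns, which
    cos ignores.\<close>
  define u where "u = Arg z * real N / (2 * pi)"
  define r where "r = round u"
  define k where "k = nat (r mod int N)"
  define q where "q = r div int N"
  have kr: "int k = r mod int N" using N by (simp add: k_def)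
  have "r = int N * q + int k"
    unfolding kr q_def by simp
  then have r_eq: "real_of_int r = real N * of_int q + real k"
    by (metis of_int_add of_int_mult of_int_of_nat_eq)
  have "cis (- (2 * pi * real k / real N)) * z = of_real (cmod z) * cis (Arg z - 2 * pi * real k / real N)"
    using rcis_cmod_Arg[of z] by (metis (no_types, lifting) rcis_def cis_mult diff_conv_add_uminus mult.commute mult.left_commute)
  then have "Re (cis (- (2 * pi * real k / real N)) * z) = cmod z * cos (Arg z - 2 * pi * real k / real N)"
    by simp
  also have "Arg z - 2 * pi * real k / real N = 2 * pi / real N * (u - of_int r) + 2 * pi * of_int q"
    using N by (simp add: u_def r_eq field_simps)
  also have "cos \<dots> = cos (2 * pi / real N * (u - of_int r))"
    by (subst cos_add) simp
  also have "\<dots> = cos \<bar>2 * pi / real N * (u - of_int r)\<bar>"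
    by (rule cos_abs_real[symmetric])
  finally have eq: "Re (cis (- (2 * pi * real k / real N)) * z) = cmod z * cos \<bar>2 * pi / real N * (u - of_int r)\<bar>" .
  have "\<bar>u - of_int r\<bar> \<le> 1 / 2"
    unfolding r_def using of_int_round_abs_le[of u] by (simp add: abs_minus_commute)
  then have "2 * pi / real N * \<bar>u - of_int r\<bar> \<le> 2 * pi / real N * (1 / 2)"
    by (intro mult_left_mono) auto
  then have "\<bar>2 * pi / real N * (u - of_int r)\<bar> \<le> pi / real N"
    by (simp add: abs_mult)
  moreover have "pi / real N \<le> pi" using N by (simp add: field_simps)
  ultimately have "cos (pi / real N) \<le> cos \<bar>2 * pi / real N * (u - of_int r)\<bar>"
    by (intro cos_monotone_0_pi_le) auto
  moreover have "k < N" using kr N by (metis of_nat_less_iff pos_mod_bound of_nat_0_less_iff less_le_trans zero_less_one)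
  ultimately have "k < N" "cmod z * cos (pi / real N) \<le> Re (cis (- (2 * pi * real k / real N)) * z)"
    unfolding eq by (simp_all only: mult_left_mono norm_ge_zero)
  then show ?thesis by blast
qed

section \<open>Moments of the cosine and its moment generating function\<close>

abbreviation unit_interval :: "real measure" where
  "unit_interval \<equiv> uniform_measure lborel {0..<1}"

lemma prob_space_unit_interval: "prob_space unit_interval"
  by (rule prob_space_uniform_measure) simp_all

lemma integral_unit_interval_FTC:
  fixes F f :: "real \<Rightarrow> real"
  assumes deriv: "\<And>y. (F has_real_derivative f y) (at y)"
    and cont: "\<And>y. isCont f y"
  shows "(\<integral>y. f y \<partial>unit_interval) = F 1 - F 0"
proof -
  have [measurable]: "f \<in> borel_measurable borel"
    using cont by (intro borel_measurable_continuous_onI) (simp add: continuous_on_eq_continuous_at)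
  have "unit_interval = density lborel (\<lambda>y. ennreal (indicator {0..<1} y))"
    by (auto simp: uniform_measure_def intro!: density_cong split: split_indicator)
  then have "(\<integral>y. f y \<partial>unit_interval) = (\<integral>y. indicator {0..<1} y *\<^sub>R f y \<partial>lborel)"
    by (simp add: integral_density)
  also have "\<dots> = (\<integral>y. f y * indicator {0..1} y \<partial>lborel)"
  proof (rule integral_cong_AE)
    \<comment> \<open>The indicators of the half-open fundamental domain and of the closed interval
      differ only at the null set {1}.\<close>
    show "AE y in lborel. indicator {0..<1} y *\<^sub>R f y = f y * indicator {0..1} y"
      using AE_lborel_singleton[of 1] by eventually_elim (auto split: split_indicator)
  qed simp_all
  also have "\<dots> = F 1 - F 0"
    by (rule integral_FTC_Icc_real) (use assms in auto)
  finally show ?thesis .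
qed

context
  fixes m :: nat and \<phi> :: real
  assumes m_pos: "m \<ge> 1"
begin

text \<open>By the lemmas below, the value depends neither on \<open>m\<close> nor on \<phi>: it is
  0 for odd \<open>k\<close> and the Wallis number binomial(2j, j) / 4^j for
  \<open>k = 2 * j\<close>.\<close>

definition cos_moment :: "nat \<Rightarrow> real" where
  "cos_moment k = (\<integral>y. cos (2 * pi * real m * y - \<phi>) ^ k \<partial>unit_interval)"

lemma integrable_cos_power: "integrable unit_interval (\<lambda>y. cos (2 * pi * real m * y - \<phi>) ^ k)"
proof -
  interpret prob_space unit_interval by (rule prob_space_unit_interval)
  show ?thesis
    by (rule integrable_const_bound[of _ 1]) (auto simp: power_abs intro!: power_le_one)
qed

lemma sin_period: "sin (2 * pi * real m - \<phi>) = sin (- \<phi>)"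
  using sin_add[of "real (2 * m) * pi" "-\<phi>"] sin_npi[of "2 * m"] cos_npi[of "2 * m"]
  by (simp add: mult_ac)

lemma cos_period: "cos (2 * pi * real m - \<phi>) = cos (- \<phi>)"
  using cos_add[of "real (2 * m) * pi" "-\<phi>"] sin_npi[of "2 * m"] cos_npi[of "2 * m"]
  by (simp add: mult_ac)

lemma cos_moment_0: "cos_moment 0 = 1"
proof -
  interpret prob_space unit_interval by (rule prob_space_unit_interval)
  show ?thesis by (simp add: cos_moment_def prob_space)
qed

lemma cos_moment_1: "cos_moment 1 = 0"
proof -
  \<comment> \<open>Here \<open>m_pos\<close> matters: for \<open>m = 0\<close> the integrand is the
    constant cos \<phi>, whose mean need not be 0.\<close>
  have "cos_moment 1 = sin (2 * pi * real m * 1 - \<phi>) / (2 * pi * real m)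
      - sin (2 * pi * real m * 0 - \<phi>) / (2 * pi * real m)"
    unfolding cos_moment_def
    by (rule integral_unit_interval_FTC) (use m_pos in \<open>auto intro!: derivative_eq_intros\<close>)
  then show ?thesis by (simp add: sin_period)
qed

text \<open>Integrate the derivative of $\cos^{k+1} \sin$ over a period.\<close>
lemma cos_moment_rec: "real (k + 2) * cos_moment (k + 2) = real (k + 1) * cos_moment k"
proof -
  let ?a = "\<lambda>y. 2 * pi * real m * y - \<phi>"
  \<comment> \<open>The denominator cancels the inner derivative of \<open>?a\<close>.\<close>
  let ?F = "\<lambda>y. cos (?a y) ^ (k + 1) * sin (?a y) / (2 * pi * real m)"
  let ?f = "\<lambda>y. real (k + 2) * cos (?a y) ^ (k + 2) - real (k + 1) * cos (?a y) ^ k"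
  have "(?F has_real_derivative ?f y) (at y)" for y
  proof -
    have dc: "((\<lambda>y. cos (?a y)) has_real_derivative - (2 * pi * real m) * sin (?a y)) (at y)"
      and ds: "((\<lambda>y. sin (?a y)) has_real_derivative 2 * pi * real m * cos (?a y)) (at y)"
      by (auto intro!: derivative_eq_intros)
    have "(?F has_real_derivative
        cos (?a y) ^ (k + 2) - real (k + 1) * cos (?a y) ^ k * sin (?a y) ^ 2) (at y)"
      by (rule DERIV_cong[OF DERIV_cdivide[OF DERIV_mult[OF DERIV_power[OF dc, of "k + 1"] ds]]])
        (use m_pos in \<open>simp add: field_simps power2_eq_square\<close>)
    \<comment> \<open>Replacing sin^2 by 1 - cos^2 leaves only powers of cos, so that integration
      relates two moments.\<close>
    also have "cos (?a y) ^ (k + 2) - real (k + 1) * cos (?a y) ^ k * sin (?a y) ^ 2 = ?f y"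
      unfolding sin_squared_eq by (simp add: algebra_simps power2_eq_square)
    finally show ?thesis .
  qed
  then have "(\<integral>y. ?f y \<partial>unit_interval) = ?F 1 - ?F 0"
    by (rule integral_unit_interval_FTC) (intro continuous_intros)
  also have "\<dots> = 0" by (simp add: sin_period cos_period)
  also have "(\<integral>y. ?f y \<partial>unit_interval)
      = real (k + 2) * cos_moment (k + 2) - real (k + 1) * cos_moment k"
    unfolding cos_moment_def
    using integrable_cos_power[of "k + 2"] integrable_cos_power[of k]
    by (simp only: Bochner_Integration.integral_diff integral_mult_right_zero integrable_mult_right)
  finally show ?thesis by simp
qed

lemma cos_moment_odd: "cos_moment (2 * k + 1) = 0"
proof (induction k)
  case 0
  then show ?case using cos_moment_1 by simp
next
  case (Suc k)
  then show ?case using cos_moment_rec[of "2 * k + 1"] by simp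
qed

text \<open>The right-hand side is the coefficient of t^(2k) in exp(t^2/4). The left-hand side
  shrinks by exactly 1/(4 (k+1)^2) from \<open>k\<close> to \<open>k + 1\<close>, the right-hand
  side only by 1/(4 (k+1)), and both are 1 at \<open>k = 0\<close>.\<close>

lemma cos_moment_even_le: "cos_moment (2 * k) / fact (2 * k) \<le> 1 / (4 ^ k * fact k)"
proof (induction k)
  case 0
  then show ?case by (simp add: cos_moment_0)
next
  case (Suc k)
  define c :: real where "c = 1 / (4 * (real k + 1)\<^sup>2)"
  have "cos_moment (2 * k + 2) = (2 * real k + 1) / (2 * real k + 2) * cos_moment (2 * k)"
    using cos_moment_rec[of "2 * k"] by (simp add: field_simps)
  moreover have "fact (2 * k + 2) = (2 * real k + 2) * ((2 * real k + 1) * fact (2 * k))"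
    by (simp add: algebra_simps)
  ultimately have "cos_moment (2 * k + 2) / fact (2 * k + 2)
      = (2 * real k + 1) / (2 * real k + 2) * cos_moment (2 * k)
        / ((2 * real k + 2) * ((2 * real k + 1) * fact (2 * k)))"
    by (rule arg_cong2[where f = "(/)"])
  also have "\<dots> = c * (cos_moment (2 * k) / fact (2 * k))"
  proof -
    \<comment> \<open>Used with \<open>u = 2 * real k + 1\<close> and \<open>v = real k + 1\<close>:
      the factor \<open>u\<close> cancels. If \<open>v\<close> or \<open>f\<close> is 0, both sides
      are 0, because division by 0 yields 0.\<close>
    have *: "u / (2 * v) * x / (2 * v * (u * f)) = 1 / (4 * v\<^sup>2) * (x / f)"
      if "u \<noteq> 0" for u v x f :: real
      using that by (simp add: power2_eq_square)
    have v: "2 * real k + 2 = 2 * (real k + 1)" by simp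
    show ?thesis unfolding c_def v by (rule *) linarith
  qed
  also have "\<dots> \<le> c * (1 / (4 ^ k * fact k))"
    by (intro mult_left_mono Suc) (simp add: c_def)
  also have "\<dots> \<le> 1 / (4 * (real k + 1)) * (1 / (4 ^ k * fact k))"
  proof (rule mult_right_mono)
    have "4 * (real k + 1) \<le> 4 * (real k + 1)\<^sup>2" using self_le_power[of "real k + 1" 2] by simp
    then show "c \<le> 1 / (4 * (real k + 1))"
      unfolding c_def by (intro divide_left_mono) auto
  qed simp
  also have "\<dots> = 1 / (4 ^ Suc k * fact (Suc k))"
    by (simp add: field_simps)
  finally show ?case by simp
qed

text \<open>The integral is the Bessel function I_0(t). Integrating the exponential series term by
  term gives a series in the cosine moments, which is bounded coefficientwise by the series of
  exp(t^2/4).\<close>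

lemma integral_exp_cos_le:
  "(\<integral>y. exp (t * cos (2 * pi * real m * y - \<phi>)) \<partial>unit_interval) \<le> exp (t\<^sup>2 / 4)"
proof -
  interpret prob_space unit_interval by (rule prob_space_unit_interval)
  let ?c = "\<lambda>y. cos (2 * pi * real m * y - \<phi>)"
  let ?f = "\<lambda>k y. (t ^ k / fact k) * ?c y ^ k"
  have norm_le: "norm (?f k y) \<le> \<bar>t\<bar> ^ k / fact k" for k y
  proof -
    have "\<bar>t\<bar> ^ k / fact k * \<bar>?c y\<bar> ^ k \<le> \<bar>t\<bar> ^ k / fact k"
      by (intro mult_left_le power_le_one) auto
    then show ?thesis by (simp add: abs_mult power_abs)
  qed
  have summable_exp: "summable (\<lambda>k. \<bar>t\<bar> ^ k / fact k)"
    using summable_exp[of "\<bar>t\<bar>"] by (simp add: divide_inverse mult.commute)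
  have int: "integrable unit_interval (?f k)" for k
    by (intro integrable_mult_right integrable_cos_power)
  have series: "(\<Sum>k. ?f k y) = exp (t * ?c y)" for y
    by (simp add: exp_def power_mult_distrib divide_inverse mult_ac)
  \<comment> \<open>Sum and integral may be exchanged: since |cos| is at most 1, the terms are
    dominated by the series of exp |t|.\<close>
  have "(\<lambda>k. integral\<^sup>L unit_interval (?f k)) sums (\<integral>y. (\<Sum>k. ?f k y) \<partial>unit_interval)"
  proof (rule sums_integral[OF int])
    show "AE y in unit_interval. summable (\<lambda>k. norm (?f k y))"
      by (intro AE_I2 summable_comparison_test_ev[OF _ summable_exp] always_eventually allI)
        (use norm_le in simp)
    show "summable (\<lambda>k. \<integral>y. norm (?f k y) \<partial>unit_interval)"
    proof (rule summable_comparison_test_ev[OF always_eventually summable_exp], rule allI)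
      fix k
      have "(\<integral>y. norm (?f k y) \<partial>unit_interval) \<le> (\<integral>y. \<bar>t\<bar> ^ k / fact k \<partial>unit_interval)"
        using norm_le by (intro integral_mono integrable_norm int) auto
      then show "norm (\<integral>y. norm (?f k y) \<partial>unit_interval) \<le> \<bar>t\<bar> ^ k / fact k"
        by (simp add: prob_space)
    qed
  qed
  moreover have "(\<lambda>k. integral\<^sup>L unit_interval (?f k)) = (\<lambda>k. t ^ k / fact k * cos_moment k)"
    unfolding cos_moment_def by (rule ext) (rule integral_mult_right_zero)
  ultimately have moments: "(\<lambda>k. t ^ k / fact k * cos_moment k) sums
      (\<integral>y. exp (t * ?c y) \<partial>unit_interval)"
    unfolding series by (rule subst[where P = "\<lambda>f. f sums (\<integral>y. exp (t * ?c y) \<partial>unit_interval)", rotated])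
  have "(\<lambda>k. u ^ k / fact k) sums exp u" for u :: real
    using exp_converges[of u] by (simp add: divide_inverse mult.commute)
  \<comment> \<open>The series of exp(t^2/4) is spread over the even indices, with zeros at the odd
    ones, to allow comparison with the moment series index by index.\<close>
  note bound = sums_if[OF sums_zero this[of "t\<^sup>2 / 4"]]
  have le: "t ^ k / fact k * cos_moment k
      \<le> (if even k then (t\<^sup>2 / 4) ^ (k div 2) / fact (k div 2) else 0)" for k
  proof (cases "even k")
    case True
    then obtain j where k: "k = 2 * j" by blast
    have "t ^ k / fact k * cos_moment k = (t\<^sup>2) ^ j * (cos_moment (2 * j) / fact (2 * j))"
      by (simp add: k power_mult)
    also have "\<dots> \<le> (t\<^sup>2) ^ j * (1 / (4 ^ j * fact j))"
      by (intro mult_left_mono cos_moment_even_le) simp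
    finally show ?thesis by (simp add: k power_divide)
  next
    case False
    then obtain j where "k = 2 * j + 1" by (rule oddE)
    then show ?thesis using cos_moment_odd[of j] by simp
  qed
  show ?thesis
    using sums_le[OF le moments bound] by simp
qed

end

section \<open>Characters on the circle\<close>

text \<open>Measurability comes from continuity. In the quotient topology an open set is recognised
  by its preimage in the reals, where the character becomes an ordinary exponential.\<close>

lemma measurable_circle_char [measurable]: "circle_char m \<in> borel_measurable borel"
proof (rule borel_measurable_continuous_onI)
  have "open (circle_char m -` U)" if "open U" for U
  proof -
    have "circle_of_real -` circle_char m -` U
        = (\<lambda>y. exp (2 * of_real pi * \<i> * of_nat m * of_real y)) -` U"
      by (auto simp: circle_char.abs_eq)
    moreover have "open \<dots>"
      by (intro open_vimage that continuous_intros)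
    ultimately show ?thesis by (simp add: open_circle_def)
  qed
  then show "continuous_on UNIV (circle_char m)"
    by (simp add: continuous_on_open_vimage)
qed

lemma Re_cis_circle_char:
  "Re (cis (- \<phi>) * circle_char m (circle_of_real y)) = cos (2 * pi * real m * y - \<phi>)"
proof -
  have "circle_char m (circle_of_real y) = cis (2 * pi * real m * y)"
    by (simp add: circle_char.abs_eq cis_conv_exp mult_ac)
  then show ?thesis by (simp add: cis_mult)
qed

lemma cmod_circle_char: "cmod (circle_char m z) = 1"
  by (transfer, simp)

lemma integral_exp_Re_circle_char_le:
  assumes "m \<ge> 1"
  shows "(\<integral>z. exp (t * Re (cis (- \<phi>) * circle_char m z)) \<partial>uniform_circle) \<le> exp (t\<^sup>2 / 4)"
  using integral_exp_cos_le[OF assms, of t \<phi>]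
  unfolding uniform_circle_def by (simp add: integral_distr Re_cis_circle_char del: times_complex.sel)

section \<open>Chernoff bound in a fixed direction\<close>

lemma (in prob_space) prob_directional_sum_ge:
  fixes x :: "nat \<Rightarrow> 'a \<Rightarrow> circle"
  assumes indep: "indep_vars (\<lambda>_. borel) x {1..n}"
    and unif: "\<And>j. j \<in> {1..n} \<Longrightarrow> distr M borel (x j) = uniform_circle"
    and m: "m \<ge> 1" and s: "s > 0"
  shows "prob {\<omega> \<in> space M. s * real n \<le> Re (cis (- \<phi>) * (\<Sum>j=1..n. circle_char m (x j \<omega>)))}
    \<le> exp (- (real n * s\<^sup>2))"
proof -
  \<comment> \<open>This \<open>t\<close> minimises the exponent n (t^2/4 - t s), with minimum -n
    s^2.\<close>
  define t where "t = 2 * s"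
  define Y where "Y j \<omega> = exp (t * Re (cis (- \<phi>) * circle_char m (x j \<omega>)))" for j \<omega>
  let ?S = "\<lambda>\<omega>. Re (cis (- \<phi>) * (\<Sum>j=1..n. circle_char m (x j \<omega>)))"
  have rv [measurable]: "random_variable borel (x j)" if "j \<in> {1..n}" for j
    using indep that by (auto simp: indep_vars_def)
  have rvY: "random_variable borel (Y j)" if "j \<in> {1..n}" for j
    using rv[OF that] unfolding Y_def by measurable
  have Y_prod: "exp (t * ?S \<omega>) = (\<Prod>j=1..n. Y j \<omega>)" for \<omega>
    unfolding Y_def by (simp add: sum_distrib_left exp_sum Re_sum del: times_complex.sel)
  \<comment> \<open>Boundedness makes each factor integrable, as the factorisation of the
    expectation by independence requires.\<close>
  have Y_bound: "norm (Y j \<omega>) \<le> exp \<bar>t\<bar>" for j \<omega>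
  proof -
    have "\<bar>Re (cis (- \<phi>) * circle_char m (x j \<omega>))\<bar> \<le> cmod (cis (- \<phi>) * circle_char m (x j \<omega>))"
      by (rule abs_Re_le_cmod)
    also have "\<dots> = 1" by (simp add: norm_mult cmod_circle_char)
    finally have "\<bar>t\<bar> * \<bar>Re (cis (- \<phi>) * circle_char m (x j \<omega>))\<bar> \<le> \<bar>t\<bar>"
      by (intro mult_left_le) auto
    then show ?thesis unfolding Y_def
      by (simp add: abs_mult[symmetric] del: times_complex.sel)
  qed
  have int: "integrable M (Y j)" if "j \<in> {1..n}" for j
    by (rule integrable_const_bound[of _ "exp \<bar>t\<bar>"]) (use Y_bound rvY[OF that] in auto)
  have indepY: "indep_vars (\<lambda>_. borel) Y {1..n}"
    unfolding Y_def by (rule indep_vars_compose2[OF indep]) measurable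
  have EY: "expectation (Y j) \<le> exp (t\<^sup>2 / 4)" if j: "j \<in> {1..n}" for j
  proof -
    have "expectation (Y j) = (\<integral>z. exp (t * Re (cis (- \<phi>) * circle_char m z)) \<partial>distr M borel (x j))"
      unfolding Y_def by (subst integral_distr) (use rv[OF j] in \<open>simp_all del: times_complex.sel\<close>)
    then show ?thesis
      using integral_exp_Re_circle_char_le[OF m] unif[OF j] by simp
  qed
  have "prob {\<omega> \<in> space M. s * real n \<le> ?S \<omega>}
      \<le> exp (- t * (s * real n)) * (\<integral>\<omega>\<in>space M. exp (t * ?S \<omega>) \<partial>M)"
  proof (rule Chernoff_ineq_ge)
    show "set_integrable M (space M) (\<lambda>\<omega>. exp (t * ?S \<omega>))"
      unfolding Y_prod set_integrable_def
      by (intro integrable_mult_indicator indep_vars_integrable[OF _ indepY int]) auto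
  qed (use s t_def in auto)
  also have "(\<integral>\<omega>\<in>space M. exp (t * ?S \<omega>) \<partial>M) = (\<integral>\<omega>. (\<Prod>j=1..n. Y j \<omega>) \<partial>M)"
    unfolding Y_prod
    by (rule set_integral_space) (rule indep_vars_integrable[OF _ indepY int], auto)
  also have "\<dots> = (\<Prod>j=1..n. expectation (Y j))"
    by (rule indep_vars_lebesgue_integral[OF _ indepY int]) auto
  also have "\<dots> \<le> (\<Prod>j=1..n. exp (t\<^sup>2 / 4))"
    by (intro prod_mono conjI EY integral_nonneg_AE) (auto simp: Y_def)
  also have "\<dots> = exp (real n * (t\<^sup>2 / 4))"
    by (simp add: exp_of_nat_mult[symmetric])
  also have "exp (- t * (s * real n)) * exp (real n * (t\<^sup>2 / 4)) = exp (- (real n * s\<^sup>2))"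
    by (simp add: t_def exp_add[symmetric] power2_eq_square algebra_simps)
  finally show ?thesis by simp
qed

section \<open>Union bound over frequencies and directions\<close>

text \<open>The complementary event is covered by \<open>L * N\<close> directional events, each
  controlled by the Chernoff bound. \<open>L\<close> is the number of frequencies, \<open>M\<close>
  being the probability space here, and \<open>N\<close> is \<nu> as a natural number.\<close>

lemma (in prob_space) one_minus_prob_small_sums_le:
  fixes x :: "nat \<Rightarrow> 'a \<Rightarrow> circle"
  assumes indep: "indep_vars (\<lambda>_. borel) x {1..n}"
    and unif: "\<And>j. j \<in> {1..n} \<Longrightarrow> distr M borel (x j) = uniform_circle"
    and \<delta>: "\<delta> > 0" and N: "N \<ge> 3"
  shows "1 - prob_small_sums M x L n \<delta> \<le> real L * real N * exp (- (real n * \<delta>\<^sup>2 * (cos (pi / real N))\<^sup>2))"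
proof -
  let ?S = "\<lambda>m \<omega>. \<Sum>j=1..n. circle_char m (x j \<omega>)"
  define a where "a = cos (pi / real N)"
  \<comment> \<open>\<open>A m k\<close> says that the sum of frequency \<open>m\<close> has a large
    component in direction 2 pi k/N. The threshold carries the factor \<open>a\<close>, the most
    that is lost when a modulus is replaced by its best component.\<close>
  define A where "A m k = {\<omega> \<in> space M. \<delta> * a * real n
    \<le> Re (cis (- (2 * pi * real k / real N)) * ?S m \<omega>)}" for m k
  \<comment> \<open>\<open>N \<ge> 3\<close> keeps the angle strictly below pi/2. Then
    \<open>a > 0\<close>, which preserves the inequality in the covering argument and makes \<delta>
    a an admissible threshold \<open>s\<close> for Chernoff.\<close>
  have "pi / real N < pi / 2" using N by (intro divide_strict_left_mono) auto
  then have a: "a > 0"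
    unfolding a_def using N by (intro cos_gt_zero_pi) (auto intro: less_trans[of _ 0])
  have rv [measurable]: "random_variable borel (x j)" if "j \<in> {1..n}" for j
    using indep that by (auto simp: indep_vars_def)
  have S [measurable]: "?S m \<in> borel_measurable M" for m
    by (intro borel_measurable_sum measurable_compose[OF rv measurable_circle_char])
  let ?E = "{\<omega> \<in> space M. \<forall>m\<in>{1..L}. cmod (?S m \<omega>) < \<delta> * real n}"
  have [measurable]: "?E \<in> events" by measurable
  have A_ev: "A m k \<in> events" for m k
    unfolding A_def by (simp del: times_complex.sel)
  have cover: "space M - ?E \<subseteq> (\<Union>(m, k)\<in>{1..L} \<times> {..<N}. A m k)"
  proof
    fix \<omega> assume "\<omega> \<in> space M - ?E"
    then obtain m where \<omega>: "\<omega> \<in> space M" and m: "m \<in> {1..L}" and ge: "\<delta> * real n \<le> cmod (?S m \<omega>)"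
      by (auto simp: not_less)
    obtain k where k: "k < N" "cmod (?S m \<omega>) * a \<le> Re (cis (- (2 * pi * real k / real N)) * ?S m \<omega>)"
      using ex_direction_Re_ge[of N "?S m \<omega>"] N unfolding a_def by auto
    have "\<delta> * a * real n \<le> cmod (?S m \<omega>) * a"
      using mult_right_mono[OF ge, of a] a by (simp add: mult_ac)
    with k(2) have "\<omega> \<in> A m k"
      unfolding A_def using \<omega> by (simp del: times_complex.sel)
    with m k(1) show "\<omega> \<in> (\<Union>(m, k)\<in>{1..L} \<times> {..<N}. A m k)" by auto
  qed
  have "1 - prob_small_sums M x L n \<delta> = prob (space M - ?E)"
    unfolding prob_small_sums_def by (simp add: prob_compl)
  also have "\<dots> \<le> prob (\<Union>(m, k)\<in>{1..L} \<times> {..<N}. A m k)"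
    using A_ev by (intro finite_measure_mono cover sets.finite_UN) auto
  also have "\<dots> \<le> (\<Sum>(m, k)\<in>{1..L} \<times> {..<N}. prob (A m k))"
    using finite_measure_subadditive_finite[of "{1..L} \<times> {..<N}" "\<lambda>(m, k). A m k"] A_ev
    by (auto simp: case_prod_beta)
  also have "\<dots> \<le> (\<Sum>(m, k)\<in>{1..L} \<times> {..<N}. exp (- (real n * (\<delta> * a)\<^sup>2)))"
    unfolding A_def case_prod_beta
    by (intro sum_mono prob_directional_sum_ge indep unif) (use \<delta> a in auto)
  also have "\<dots> = real L * real N * exp (- (real n * \<delta>\<^sup>2 * a\<^sup>2))"
    by (simp add: power_mult_distrib mult_ac)
  finally show ?thesis unfolding a_def .
qed

theorem theorem1:
  fixes \<Omega> :: "'a measure" and x :: "nat \<Rightarrow> 'a \<Rightarrow> circle"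
    and n M :: nat and \<delta> :: real
  assumes "n \<ge> 2" and "0 < \<delta>" and "\<delta> < 1" and "M \<ge> 1"
    and "prob_space \<Omega>"
    and "prob_space.indep_vars \<Omega> (\<lambda>_. borel) x {1..n}"
    and "\<And>j. j \<in> {1..n} \<Longrightarrow> distr \<Omega> borel (x j) = uniform_circle"
  shows "(\<forall>\<nu>::int. \<nu> \<ge> 3 \<longrightarrow>
      1 - prob_small_sums \<Omega> x M n \<delta>
        \<le> real M * of_int \<nu> * exp (- (real n * \<delta>\<^sup>2 * (cos (pi / of_int \<nu>))\<^sup>2)))
    \<and> (\<lfloor>\<delta> * pi * sqrt (2 * real n)\<rfloor> \<ge> 3 \<longrightarrow>
      1 - prob_small_sums \<Omega> x M n \<delta>
        \<le> real M * of_int \<lfloor>\<delta> * pi * sqrt (2 * real n)\<rfloor>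
          * exp (- (real n * \<delta>\<^sup>2 * (cos (pi / of_int \<lfloor>\<delta> * pi * sqrt (2 * real n)\<rfloor>))\<^sup>2)))"
proof -
  interpret prob_space \<Omega> by (fact assms(5))
  have bound: "1 - prob_small_sums \<Omega> x M n \<delta>
      \<le> real M * of_int \<nu> * exp (- (real n * \<delta>\<^sup>2 * (cos (pi / of_int \<nu>))\<^sup>2))"
    if "\<nu> \<ge> 3" for \<nu> :: int
  proof -
    \<comment> \<open>The integer \<nu>, of the type that floor returns, is passed to the
      natural-number version.\<close>
    have "real (nat \<nu>) = of_int \<nu>" "nat \<nu> \<ge> 3" using that by simp_all
    then show ?thesis
      using one_minus_prob_small_sums_le[OF assms(6,7,2), of "nat \<nu>" M] by (simp only:)
  qed
  \<comment> \<open>The second conjunct is the instance of \<open>bound\<close> at the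
    floor.\<close>
  show ?thesis by (intro conjI allI impI; rule bound)
qed

end
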